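(* Let $\Phi:M_d(\mathbb C)\to M_d(\mathbb C)$ be completely positive, with Kraus form $\Phi(X)=\sum_{a=1}^N K_aXK_a^\dagger$. For basis labels $i,r\in\{1,\dots,d\}$ define the vector in $\mathbb C^N$ $$|v_{r|i}\rangle:=\sum_{a=1}^N (K_a)_{ri}\,|a\rangle .$$ Then for all basis labels $i,j,r,s$, $$p(r|i):=\langle r|\Phi(|i\rangle\langle i|)|r\rangle=\|v_{r|i}\|^2,\qquad \langle r|\Phi(|i\rangle\langle j|)|s\rangle=\langle v_{s|j},v_{r|i}\rangle .$$ Consequently, $$\bigl|\langle r|\Phi(|i\rangle\langle j|)|s\rangle\bigr|\le\sqrt{p(r|i)\,p(s|j)},$$ and, when $v_{r|i}$ and $v_{s|j}$ are nonzero, equality holds if and only if $v_{r|i}$ and $v_{s|j}$ are complex-collinear (linearly dependent over $\mathbb C$).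
   Context: $\{|i\rangle\}_{i=1}^d$ is the standard orthonormal basis of $\mathbb C^d$, $(K_a)_{ri}=\langle r|K_a|i\rangle$, $\{|a\rangle\}_{a=1}^N$ is the standard orthonormal basis of $\mathbb C^N$, and inner products are conjugate-linear in the first argument and linear in the second. *)

theory Defs
  imports "HOL-Analysis.Analysis"
begin

text \<open>
  The class inner product on \<^typ>\<open>complex^'n\<close> is the real part of the Hermitian one, so the
  Hermitian one is introduced here; the class norm is the usual Hermitian norm.
\<close>

definition cinner :: "complex^'n \<Rightarrow> complex^'n \<Rightarrow> complex" where
  "cinner v w = (\<Sum>a\<in>UNIV. cnj (v $ a) * w $ a)"

definition dagger :: "complex^'m^'n \<Rightarrow> complex^'n^'m" where
  "dagger A = map_matrix cnj (transpose A)"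

abbreviation ket :: "'n::finite \<Rightarrow> complex^'n" where
  "ket i \<equiv> axis i 1"

definition ketbra :: "complex^'m \<Rightarrow> complex^'n \<Rightarrow> complex^'n^'m" where
  "ketbra u w = (\<chi> i j. u $ i * cnj (w $ j))"

definition matrix_element :: "'m::finite \<Rightarrow> complex^'n^'m \<Rightarrow> 'n::finite \<Rightarrow> complex" where
  "matrix_element r A s = cinner (ket r) (A *v ket s)"

text \<open>
  A family \<open>X a b\<close> with \<open>a, b < k\<close> of d-by-d matrices encodes a k-by-k block matrix,
  i.e. an element of the tensor product of the k-by-k with the d-by-d matrices; the families
  \<open>\<xi>\<close> below are the block vectors. On such families the k-th amplification of a map
  \<open>\<Phi>\<close> acts blockwise. The set \<open>\<real>\<^sub>\<ge>\<^sub>0\<close> consists of complex numbers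
  with zero imaginary part and nonnegative real part.
\<close>

definition block_positive :: "nat \<Rightarrow> (nat \<Rightarrow> nat \<Rightarrow> complex^'d^'d) \<Rightarrow> bool" where
  "block_positive k X \<longleftrightarrow>
     (\<forall>\<xi> :: nat \<Rightarrow> complex^'d. (\<Sum>a<k. \<Sum>b<k. cinner (\<xi> a) (X a b *v \<xi> b)) \<in> \<real>\<^sub>\<ge>\<^sub>0)"

definition completely_positive :: "(complex^'d^'d \<Rightarrow> complex^'d^'d) \<Rightarrow> bool" where
  "completely_positive \<Phi> \<longleftrightarrow>
     Vector_Spaces.linear (\<lambda>c. map_matrix ((*) c)) (\<lambda>c. map_matrix ((*) c)) \<Phi> \<and>
     (\<forall>k X. block_positive k X \<longrightarrow> block_positive k (\<lambda>a b. \<Phi> (X a b)))"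

definition kraus_form ::
    "('n::finite \<Rightarrow> complex^'d^'d) \<Rightarrow> (complex^'d^'d \<Rightarrow> complex^'d^'d) \<Rightarrow> bool" where
  "kraus_form K \<Phi> \<longleftrightarrow> (\<forall>X. \<Phi> X = (\<Sum>a\<in>UNIV. K a ** X ** dagger (K a)))"

definition kraus_vector ::
    "('n::finite \<Rightarrow> complex^'d^'d) \<Rightarrow> 'd::finite \<Rightarrow> 'd \<Rightarrow> complex^'n" where
  "kraus_vector K r i = (\<Sum>a\<in>UNIV. matrix_element r (K a) i *s ket a)"

text \<open>
  The quantity \<open>p(r|i)\<close> as a real number. The matrix element is real for every positive
  \<open>\<Phi>\<close>, so that taking the real part only changes the type.
\<close>

definition transition_weight :: "(complex^'d^'d \<Rightarrow> complex^'d^'d) \<Rightarrow> 'd::finite \<Rightarrow> 'd \<Rightarrow> real" where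
  "transition_weight \<Phi> r i = Re (matrix_element r (\<Phi> (ketbra (ket i) (ket i))) r)"

text \<open>
  Linear dependence of the pair \<open>(v, w)\<close> as a family. The set-based \<open>vec.dependent {v, w}\<close>
  would be wrong for \<open>v = w \<noteq> 0\<close>.
\<close>

definition complex_collinear :: "complex^'n \<Rightarrow> complex^'n \<Rightarrow> bool" where
  "complex_collinear v w \<longleftrightarrow>
     (\<exists>\<alpha> \<beta>. (\<alpha> \<noteq> 0 \<or> \<beta> \<noteq> 0) \<and> \<alpha> *s v + \<beta> *s w = 0)"

end

theory Submission
  imports Defs
begin

text \<open>
  The Kraus form exhibits every matrix element of \<open>\<Phi>\<close> on a matrix unit as a Gram entry of
  the Kraus vectors. The inequality and its
  equality case are those of Cauchy--Schwarz, both read off from the squared norm of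
  \<open>\<parallel>w\<parallel>\<^sup>2 v - \<langle>w, v\<rangle> w\<close>.
\<close>

lemma cinner_commute: "cinner w v = cnj (cinner v w)"
  by (simp add: cinner_def mult.commute)

lemma cinner_diff_left: "cinner (u - v) w = cinner u w - cinner v w"
  by (simp add: cinner_def left_diff_distrib sum_subtractf)

lemma cinner_diff_right: "cinner u (v - w) = cinner u v - cinner u w"
  by (simp add: cinner_def right_diff_distrib sum_subtractf)

lemma cinner_scale_left: "cinner (c *s v) w = cnj c * cinner v w"
  by (simp add: cinner_def sum_distrib_left mult.assoc)

lemma cinner_scale_right: "cinner v (c *s w) = c * cinner v w"
  by (simp add: cinner_def sum_distrib_left mult.left_commute)

lemma cinner_self: "cinner v v = complex_of_real ((norm v)\<^sup>2)"
proof -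
  have "(norm v)\<^sup>2 = (\<Sum>a\<in>UNIV. (cmod (v $ a))\<^sup>2)"
    by (simp add: norm_vec_def L2_set_def sum_nonneg)
  then show ?thesis
    by (simp only: cinner_def of_real_sum complex_norm_square mult.commute)
qed

lemma norm_scale_vec: "norm (c *s v) = cmod c * norm (v :: complex^'n)"
  by (simp add: norm_vec_def norm_mult L2_set_right_distrib)

text \<open>For \<open>w \<noteq> 0\<close> the vector on the left is the component of
  \<open>v\<close> orthogonal to \<open>w\<close>, multiplied by \<open>(norm w)\<^sup>2\<close>.
  Avoiding the division keeps the identity polynomial, so \<open>w = 0\<close> needs no separate
  case.\<close>

lemma norm_cinner_residual:
  "(norm (complex_of_real ((norm w)\<^sup>2) *s v - cinner w v *s w))\<^sup>2
     = (norm w)\<^sup>2 * ((norm v)\<^sup>2 * (norm w)\<^sup>2 - (cmod (cinner w v))\<^sup>2)"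
proof -
  define V W z where "V = complex_of_real ((norm v)\<^sup>2)"
    and "W = complex_of_real ((norm w)\<^sup>2)" and "z = cinner w v"
  \<comment> \<open>\<open>W\<close> is real, hence fixed by conjugation. With these values the
    expansion becomes a polynomial identity in \<open>V\<close>, \<open>W\<close>, \<open>z\<close>
    and \<open>cnj z\<close>.\<close>
  have entries: "cinner v v = V" "cinner w w = W" "cinner w v = z" "cinner v w = cnj z" "cnj W = W"
    by (simp_all only: V_def W_def z_def cinner_self cinner_commute [of v w]
        complex_cnj_complex_of_real)
  have "complex_of_real ((norm (W *s v - z *s w))\<^sup>2) = cinner (W *s v - z *s w) (W *s v - z *s w)"
    by (simp only: cinner_self)
  \<comment> \<open>Of the four terms, one cross term cancels against the contribution of
    \<open>z *s w\<close> with itself.\<close>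
  also have "\<dots> = W * (V * W - z * cnj z)"
    by (simp only: cinner_diff_left cinner_diff_right cinner_scale_left cinner_scale_right entries)
       (simp add: algebra_simps)
  also have "\<dots> = complex_of_real ((norm w)\<^sup>2 * ((norm v)\<^sup>2 * (norm w)\<^sup>2 - (cmod z)\<^sup>2))"
    by (simp only: V_def W_def of_real_mult of_real_diff complex_norm_square)
  finally show ?thesis
    unfolding of_real_eq_iff W_def z_def .
qed

lemma cmod_cinner_le: "cmod (cinner w v) \<le> norm v * norm w"
proof (cases "w = 0")
  case True
  then show ?thesis
    by (simp add: cinner_def)
next
  case False
  \<comment> \<open>The product is a squared norm; its first factor is positive, so the second one
    is nonnegative.\<close>
  have "0 \<le> (norm w)\<^sup>2 * ((norm v)\<^sup>2 * (norm w)\<^sup>2 - (cmod (cinner w v))\<^sup>2)"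
    unfolding norm_cinner_residual [symmetric] by simp
  with False have "(cmod (cinner w v))\<^sup>2 \<le> (norm v * norm w)\<^sup>2"
    by (simp add: zero_le_mult_iff power_mult_distrib)
  then show ?thesis
    by (rule power2_le_imp_le) simp
qed

lemma complex_collinear_iff:
  assumes "w \<noteq> 0"
  shows "complex_collinear v w \<longleftrightarrow> (\<exists>c. v = c *s w)"
proof
  assume "complex_collinear v w"
  then obtain \<alpha> \<beta> where nz: "\<alpha> \<noteq> 0 \<or> \<beta> \<noteq> 0" and eq: "\<alpha> *s v + \<beta> *s w = 0"
    unfolding complex_collinear_def by blast
  \<comment> \<open>Otherwise \<open>\<beta> \<noteq> 0\<close> and \<open>\<beta> *s w = 0\<close>,
    against \<open>w \<noteq> 0\<close>.\<close>
  have "\<alpha> \<noteq> 0"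
    using nz eq assms by auto
  moreover have "\<alpha> * v $ a = - (\<beta> * w $ a)" for a
    using eq by (simp add: vec_eq_iff eq_neg_iff_add_eq_0)
  ultimately have "v = (- \<beta> / \<alpha>) *s w"
    by (simp add: vec_eq_iff field_simps)
  then show "\<exists>c. v = c *s w" ..
next
  assume "\<exists>c. v = c *s w"
  then obtain c where "v = c *s w" ..
  then have "1 *s v + (- c) *s w = 0"
    by (simp add: vec_eq_iff)
  then show "complex_collinear v w"
    unfolding complex_collinear_def using one_neq_zero by blast
qed

lemma cmod_cinner_eq_iff:
  assumes "w \<noteq> 0"
  shows "cmod (cinner w v) = norm v * norm w \<longleftrightarrow> complex_collinear v w"
proof
  assume "cmod (cinner w v) = norm v * norm w"
  \<comment> \<open>Equality annihilates the second factor of the residual identity. The vanishing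
    residual is itself the required linear relation, nontrivial because the coefficient of
    \<open>v\<close> is \<open>(norm w)\<^sup>2\<close>.\<close>
  then have "(norm (complex_of_real ((norm w)\<^sup>2) *s v - cinner w v *s w))\<^sup>2 = 0"
    unfolding norm_cinner_residual by (simp add: power_mult_distrib)
  then have "complex_of_real ((norm w)\<^sup>2) *s v + (- cinner w v) *s w = 0"
    by (simp add: vec_eq_iff)
  moreover have "complex_of_real ((norm w)\<^sup>2) \<noteq> 0"
    using assms by simp
  ultimately show "complex_collinear v w"
    unfolding complex_collinear_def by blast
next
  assume "complex_collinear v w"
  then obtain c where "v = c *s w"
    using complex_collinear_iff [OF assms] by blast
  \<comment> \<open>Both sides equal \<open>cmod c * (norm w)\<^sup>2\<close>.\<close>
  then show "cmod (cinner w v) = norm v * norm w"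
    by (simp add: cinner_scale_right cinner_self norm_scale_vec norm_mult norm_power
        power2_eq_square)
qed

lemma ket_nth: "ket i $ k = (if k = i then 1 else 0 :: complex)"
  by (simp add: axis_def)

text \<open>Brings a conjugated Kronecker delta into the shape on which sums over deltas
  collapse.\<close>

lemma cnj_delta: "cnj (if P then 1 else 0) = (if P then 1 else 0)"
  by simp

lemma matrix_element_nth: "matrix_element r A s = A $ r $ s"
proof -
  have "cinner (ket r) v = v $ r" for v :: "complex^'a"
    by (simp add: cinner_def ket_nth cnj_delta mult_delta_left)
  moreover have "(A *v ket s) $ r = A $ r $ s"
    by (simp add: matrix_vector_mult_def ket_nth mult_delta_right)
  ultimately show ?thesis
    by (simp add: matrix_element_def)
qed

lemma kraus_vector_nth: "kraus_vector K r i $ a = K a $ r $ i"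
  by (simp add: kraus_vector_def matrix_element_nth ket_nth mult_delta_right)

text \<open>Each Kraus operator contributes its entry at \<open>(r, i)\<close> times the conjugate
  of its entry at \<open>(s, j)\<close>. The conjugate stems from \<open>dagger\<close>, which is
  why the vector for \<open>(s, j)\<close> stands in the conjugate-linear slot.\<close>

lemma matrix_element_kraus_form:
  assumes "kraus_form K \<Phi>"
  shows "matrix_element r (\<Phi> (ketbra (ket i) (ket j))) s
           = cinner (kraus_vector K s j) (kraus_vector K r i)"
proof -
  \<comment> \<open>Right multiplication by a matrix unit moves column \<open>i\<close> to position
    \<open>j\<close> and clears all other columns.\<close>
  have column: "(A ** ketbra (ket i) (ket j)) $ r $ k = (if k = j then A $ r $ i else 0)"
    for A :: "complex^'b^'b" and k
    by (cases "k = j") (simp_all add: matrix_matrix_mult_def ketbra_def ket_nth mult_delta_right)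
  \<comment> \<open>Only the outer product is unfolded, so that \<open>column\<close> still matches
    the inner one.\<close>
  have "(A ** ketbra (ket i) (ket j) ** dagger A) $ r $ s
      = (\<Sum>k\<in>UNIV. (A ** ketbra (ket i) (ket j)) $ r $ k * cnj (A $ s $ k))"
    for A :: "complex^'b^'b"
    by (simp add: matrix_matrix_mult_def [of "A ** ketbra (ket i) (ket j)"]
        dagger_def map_matrix_def transpose_def)
  then have "(A ** ketbra (ket i) (ket j) ** dagger A) $ r $ s = cnj (A $ s $ j) * A $ r $ i"
    for A :: "complex^'b^'b"
    by (simp add: column mult_delta_left)
  then show ?thesis
    using assms
    by (simp add: kraus_form_def matrix_element_nth cinner_def kraus_vector_nth)
qed

theorem theorem1:
  fixes \<Phi> :: "complex^'d^'d \<Rightarrow> complex^'d^'d"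
    and K :: "'n::finite \<Rightarrow> complex^'d^'d"
    and i j r s :: "'d::finite"
  assumes "completely_positive \<Phi>"
    and "kraus_form K \<Phi>"
  shows "matrix_element r (\<Phi> (ketbra (ket i) (ket i))) r = complex_of_real (transition_weight \<Phi> r i)
       \<and> transition_weight \<Phi> r i = (norm (kraus_vector K r i))\<^sup>2
       \<and> matrix_element r (\<Phi> (ketbra (ket i) (ket j))) s
           = cinner (kraus_vector K s j) (kraus_vector K r i)
       \<and> cmod (matrix_element r (\<Phi> (ketbra (ket i) (ket j))) s)
           \<le> sqrt (transition_weight \<Phi> r i * transition_weight \<Phi> s j)
       \<and> (kraus_vector K r i \<noteq> 0 \<and> kraus_vector K s j \<noteq> 0 \<longrightarrow>
            (cmod (matrix_element r (\<Phi> (ketbra (ket i) (ket j))) s)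
               = sqrt (transition_weight \<Phi> r i * transition_weight \<Phi> s j)
             \<longleftrightarrow> complex_collinear (kraus_vector K r i) (kraus_vector K s j)))"
proof -
  note elem = matrix_element_kraus_form [OF assms(2)]
  \<comment> \<open>The diagonal case of \<open>elem\<close>. Keeping the square inside
    \<open>complex_of_real\<close> lets \<open>Re\<close> cancel it.\<close>
  have weight: "transition_weight \<Phi> r i = (norm (kraus_vector K r i))\<^sup>2" for r i
    by (simp add: transition_weight_def elem cinner_self del: of_real_power)
  then have bound: "sqrt (transition_weight \<Phi> r i * transition_weight \<Phi> s j)
      = norm (kraus_vector K r i) * norm (kraus_vector K s j)"
    by (simp add: real_sqrt_mult)
  show ?thesis
    \<comment> \<open>What remains is Cauchy--Schwarz and its equality case, with the vector for
      \<open>(r, i)\<close> as \<open>v\<close> and the one for \<open>(s, j)\<close> as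
      \<open>w\<close>.\<close>
    unfolding bound elem
    by (simp add: weight cinner_self cmod_cinner_le cmod_cinner_eq_iff)
qed

end
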